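(* Let $P$ and $W$ be the monads on $[\mathcal H^{\mathrm{op}},\mathbf{Set}]$ induced by the free-forgetful adjunctions $\{w,p\}\text{-}\mathbf{GAT}\leftrightarrows[\mathcal H^{\mathrm{op}},\mathbf{Set}]$ and $\{w\}\text{-}\mathbf{GAT}\leftrightarrows[\mathcal H^{\mathrm{op}},\mathbf{Set}]$ respectively, and let $\theta_X\colon WX\to PX$ be the evident inclusion. For each $X\in[\mathcal H^{\mathrm{op}},\mathbf{Set}]$, the unit $\eta^P_X\colon X\to PX$ of $P$ is the composite $\theta_X\circ\eta^W_X\colon X\to WX\to PX$.
   Context: \textbf{Expressions and judgements.} Fix a denumerable set $\mathrm{Var}$ of variables. Given an alphabet $\Xi$, the expressions over $\Xi$ are generated as follows: each $x\in\mathrm{Var}$ is an expression; if $n\geq 0$, $e_1,\dots,e_n$ are expressions and $w\in\Xi$, then $w(e_1,\dots,e_n)$ is an expression (written $w$ when $n=0$). $\mathsf{fv}$ denotes free variables and $e'[e/x]$ substitution of $e$ for $x$ in $e'$. A context is a (possibly empty) list $x_1:T_1,\dots,x_n:T_n$ of distinct variables $x_i$ and expressions $T_i$; $\mathsf{fv}(\Gamma)$ is the set of variables occurring in $\Gamma$. A judgement is a string $\Gamma\vdash T\ \mathsf{type}$ (type judgement), $\Gamma\vdash t:T$ (term judgement), $\Gamma\vdash T=T'\ \mathsf{type}$ (type equality) or $\Gamma\vdash t=t':T$ (term equality), with $\Gamma$ a context and $t,t',T,T'$ expressions; its degree is one more than the length of $\Gamma$. The boundary of a judgement is a list of judgements: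 $\partial(\vdash T\ \mathsf{type})=()$; $\partial(\Gamma,x:T\vdash T'\ \mathsf{type})=(\Gamma\vdash T\ \mathsf{type})$; $\partial(\Gamma\vdash t:T)=(\Gamma\vdash T\ \mathsf{type})$; $\partial(\Gamma\vdash T=T'\ \mathsf{type})=(\Gamma\vdash T\ \mathsf{type},\ \Gamma\vdash T'\ \mathsf{type})$; $\partial(\Gamma\vdash t=t':T)=(\Gamma\vdash t:T,\ \Gamma\vdash t':T)$. \textbf{Deduction rules} (premises $\Longrightarrow$ conclusion; $\mathcal J$ stands for the right-hand side of any of the four judgement forms). \emph{Equality and $\alpha$ rules}: $\Gamma\vdash t:T\Longrightarrow\Gamma\vdash t=t:T$; $\Gamma\vdash t_1=t_2:T\Longrightarrow\Gamma\vdash t_2=t_1:T$; $\Gamma\vdash t_1=t_2:T$ and $\Gamma\vdash t_2=t_3:T\Longrightarrow\Gamma\vdash t_1=t_3:T$; $\Gamma\vdash T\ \mathsf{type}\Longrightarrow\Gamma\vdash T=T\ \mathsf{type}$; $\Gamma\vdash T_1=T_2\ \mathsf{type}\Longrightarrow\Gamma\vdash T_2=T_1\ \mathsf{type}$; $\Gamma\vdash T_1=T_2\ \mathsf{type}$ and $\Gamma\vdash T_2=T_3\ \mathsf{type}\Longrightarrow\Gamma\vdash T_1=T_3\ \mathsf{type}$; $\Gamma\vdash T_1=T_2\ \mathsf{type}$ and $\Gamma\vdash t:T_1\Longrightarrow\Gamma\vdash t:T_2$; $\Gamma\vdash T_1=T_2\ \mathsf{type}$ and $\Gamma\vdash t_1=t_2:T_1\Longrightarrow\Gamma\vdash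 t_1=t_2:T_2$; $\Gamma\vdash\mathcal J\Longrightarrow\sigma\cdot\Gamma\vdash\sigma\cdot\mathcal J$ for any permutation $\sigma\in\mathrm{Sym}(\mathrm{Var})$ acting on variables. \emph{Weakening} ($w$): $\Gamma\vdash T\ \mathsf{type}$ and $\Gamma,\Delta\vdash\mathcal J\Longrightarrow\Gamma,y:T,\Delta\vdash\mathcal J$, for $y\notin\mathsf{fv}(\Gamma)\cup\mathsf{fv}(\Delta)$. \emph{Projection} ($p$): $\Gamma\vdash T\ \mathsf{type}\Longrightarrow\Gamma,y:T\vdash y:T$, for $y\notin\mathsf{fv}(\Gamma)$. \textbf{$D$-GATs.} Let $D=\{w\}$ or $D=\{w,p\}$. A $D$-GAT $\mathbb T$ consists of a collection $\Omega$ of type-constants, a collection $\Sigma$ of term-constants and a collection $\Lambda$ of basic judgements over $\Omega\amalg\Sigma$ such that: for each $A\in\Omega$ there is a unique judgement in $\Lambda$ of the form $x_1:T_1,\dots,x_{n-1}:T_{n-1}\vdash A(x_1,\dots,x_{n-1})\ \mathsf{type}$; for each $f\in\Sigma$ there is a unique judgement in $\Lambda$ of the form $x_1:T_1,\dots,x_{n-1}:T_{n-1}\vdash f(x_1,\dots,x_{n-1}):T$; all other elements of $\Lambda$ are type or term equality judgements; each element of $\Lambda$ lies in $\mathbb T^*$. Here $\mathbb T^*$, the collection of derived judgements, is the smallest collection closed under the equality and $\alpha$ rules and the rules in $D$, and containing $\mathcal J\in\Lambda$ whenever it contains each judgement in $\partial(\mathcal J)$. An interpretation $\phi\colon\mathbb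 T\to\mathbb U$ of $D$-GATs is a function $\phi\colon\mathbb T^*\to\mathbb U^*$ preserving boundaries and preserving deduction: viewing each available rule with $n$ premises (for each choice of parameters such as $y$ or $\sigma$) as an $n$-ary partial function $r$ on judgements, $\phi(r(\mathcal J_1,\dots,\mathcal J_n))=r(\phi(\mathcal J_1),\dots,\phi(\mathcal J_n))$ whenever both sides are defined. On derived type judgements, $(x_1:S_1,\dots,x_{n-1}:S_{n-1}\vdash S_n\ \mathsf{type})\equiv(y_1:T_1,\dots,y_{m-1}:T_{m-1}\vdash T_m\ \mathsf{type})$ iff $n=m$ and for $1\le i\le n$ the judgement $x_1:S_1,\dots,x_{i-1}:S_{i-1}\vdash S_i=T_i[x_1/y_1,\dots,x_{i-1}/y_{i-1}]\ \mathsf{type}$ is derived. On derived term judgements, $(x_1:S_1,\dots,x_{n-1}:S_{n-1}\vdash s:S_n)\equiv(y_1:T_1,\dots,y_{m-1}:T_{m-1}\vdash t:T_m)$ iff their boundaries are $\equiv$ and $x_1:S_1,\dots,x_{n-1}:S_{n-1}\vdash s=t[x_1/y_1,\dots,x_{n-1}/y_{n-1}]:S_n$ is derived. $D\text{-}\mathbf{GAT}$ has $D$-GATs as objects and, as morphisms, interpretations modulo: $\phi\sim\phi'$ iff $\phi(\mathcal J)\equiv\phi'(\mathcal J)$ for each derived type or term judgement $\mathcal J$. \textbf{Type-and-term structures and the monads.} $[a,b]=\{a,\dots,b\}\subset\mathbb N$ and $[n]=[1,n]$. $\mathcal H$ is the category freely generated by the graph with objects $n$ and $n_t$ ($n\ge1$)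 and arrows $n\to n+1$ and $n\to n_t$. For $X\in[\mathcal H^{\mathrm{op}},\mathbf{Set}]$ the maps $X(n+1)\to X(n)$, $X(n_t)\to X(n)$ are written $\partial$; elements of $X(n)$ are type-elements, elements of $X(n_t)$ term-elements; for $A\in X(n)$, $\mathrm{Tm}_X(A)=\{a\in X(n_t):\partial a=A\}$. The forgetful functor $V_D\colon D\text{-}\mathbf{GAT}\to[\mathcal H^{\mathrm{op}},\mathbf{Set}]$ has $V_D\mathbb T(n)$ (resp. $V_D\mathbb T(n_t)$) the set of derived type (resp. term) judgements of degree $n$ modulo $\equiv$, boundaries induced by $\partial$, and $V_D\phi([\mathcal J])=[\phi(\mathcal J)]$. Its left adjoint $G_D$ sends $X$ to the free $D$-GAT $G_DX$ whose type- and term-constants are the type- and term-elements of $X$ and whose basic judgements are $\mathcal J_A=(x_1:A_1,x_2:A_2(x_1),\dots,x_{n-1}:A_{n-1}(x_1,\dots,x_{n-2})\vdash A(x_1,\dots,x_{n-1})\ \mathsf{type})$ for $A\in X(n)$, where $A_i=\partial^{n-i}A$, and, in the same context, $\mathcal J_a=(\dots\vdash a(x_1,\dots,x_{n-1}):A(x_1,\dots,x_{n-1}))$ for $a\in\mathrm{Tm}_X(A)$. The adjunction unit is $A\mapsto[\mathcal J_A]$, $a\mapsto[\mathcal J_a]$. The monads are $W=V_{\{w\}}G_{\{w\}}$ and $P=V_{\{w,p\}}G_{\{w,p\}}$, with units $\eta^W$, $\eta^P$. \textbf{Description of $W$, $P$ and $\theta$.} A min-heap of size $n$ is a function $\phi\colon[0,n]\to[0,n]$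 with $\phi(0)=0$ and $\phi(i)<i$ for $i\in[n]$; $\mathrm{Hp}(n)$ is the set of these; $\mathsf{dp}_\phi(i)=|\{\phi(i),\phi^2(i),\dots\}|$ for $i\in[n]$; the presheaf $[\phi]$ has $[\phi](m)=\{i\in[n]:\mathsf{dp}_\phi(i)=m\}$, $[\phi](m_t)=\emptyset$, $\partial(i)=\phi(i)$. One has $PX(n)=WX(n)=\sum_{\phi\in\mathrm{Hp}(n)}[\mathcal H^{\mathrm{op}},\mathbf{Set}]([\phi],X)$, with boundary given by restriction, $\mathrm{Tm}_{WX}(\phi,h)=\mathrm{Tm}_X(h(n))$ and $\mathrm{Tm}_{PX}(\phi,h)=\mathrm{Tm}_X(h(n))+\{\pi_i:i\in[n-1],\phi(n)=\phi(i),h(n)=h(i)\}$. Here $(\phi,h)$ is identified with the class of the judgement $x_1:T_1,\dots,x_{n-1}:T_{n-1}\vdash T_n\ \mathsf{type}$ with $T_i=h(i)(x_{j_1},\dots,x_{j_{k-1}})$, $k=\mathsf{dp}_\phi(i)$, $j_\ell=\phi^{k-\ell}(i)$; $a\in\mathrm{Tm}_X(h(n))$ with the class of $x_1:T_1,\dots,x_{n-1}:T_{n-1}\vdash a(x_{j_1},\dots,x_{j_{k-1}}):T_n$ (indices for $i=n$); and $\pi_i$ with the class of $x_1:T_1,\dots,x_{n-1}:T_{n-1}\vdash x_i:T_i$. The map $\theta_X\colon WX\to PX$ is the identity on type-elements and the inclusion of the left-hand summand on term-elements. *)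

theory Defs
  imports Main "HOL-Library.FuncSet"
begin

type_synonym var = nat

datatype 'w expr = Var var | App 'w "'w expr list"

primrec fv :: "'w expr \<Rightarrow> var set" where
  "fv (Var x) = {x}"
| "fv (App w es) = \<Union> (set (map fv es))"

primrec subst :: "(var \<Rightarrow> 'w expr) \<Rightarrow> 'w expr \<Rightarrow> 'w expr" where
  "subst s (Var x) = s x"
| "subst s (App w es) = App w (map (subst s) es)"

text \<open>\<open>replace_vars xs ys e\<close> is the simultaneous substitution \<open>e[x1/y1, x2/y2, ...]\<close> of the
  variables \<open>xs\<close> for the variables \<open>ys\<close>.\<close>

definition replace_vars :: "var list \<Rightarrow> var list \<Rightarrow> 'w expr \<Rightarrow> 'w expr" where
  "replace_vars xs ys =
     subst (\<lambda>v. case map_of (zip ys xs) v of None \<Rightarrow> Var v | Some x \<Rightarrow> Var x)"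

text \<open>The parameter \<open>'e\<close> is the type of expressions. \<open>HasType t T\<close> is \<open>t : T\<close> and
  \<open>EqTerm t t' T\<close> is \<open>t = t' : T\<close>.\<close>

datatype 'e rhs = IsType 'e | HasType 'e 'e | EqType 'e 'e | EqTerm 'e 'e 'e

text \<open>Contexts are written in the usual order, so the last declaration is at the end of the list.\<close>

type_synonym 'w ctx = "(var \<times> 'w expr) list"
type_synonym 'w judgement = "'w ctx \<times> 'w expr rhs"

definition ctx_vars :: "'w ctx \<Rightarrow> var set" where
  "ctx_vars \<Gamma> = (\<Union>(x, T)\<in>set \<Gamma>. insert x (fv T))"

definition judgement_over :: "'w set \<Rightarrow> 'w judgement \<Rightarrow> bool" where
  "judgement_over S J \<longleftrightarrow> distinct (map fst (fst J)) \<and>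
     (\<forall>T\<in>snd ` set (fst J). set_expr T \<subseteq> S) \<and> (\<forall>e\<in>set_rhs (snd J). set_expr e \<subseteq> S)"

definition degree :: "'w judgement \<Rightarrow> nat" where
  "degree J = Suc (length (fst J))"

fun boundary :: "'w judgement \<Rightarrow> 'w judgement list" where
  "boundary (\<Gamma>, IsType T) = (if \<Gamma> = [] then [] else [(butlast \<Gamma>, IsType (snd (last \<Gamma>)))])"
| "boundary (\<Gamma>, HasType t T) = [(\<Gamma>, IsType T)]"
| "boundary (\<Gamma>, EqType T T') = [(\<Gamma>, IsType T), (\<Gamma>, IsType T')]"
| "boundary (\<Gamma>, EqTerm t t' T) = [(\<Gamma>, HasType t T), (\<Gamma>, HasType t' T)]"

definition permute_expr :: "(var \<Rightarrow> var) \<Rightarrow> 'w expr \<Rightarrow> 'w expr" where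
  "permute_expr \<sigma> = subst (\<lambda>v. Var (\<sigma> v))"

definition permute_ctx :: "(var \<Rightarrow> var) \<Rightarrow> 'w ctx \<Rightarrow> 'w ctx" where
  "permute_ctx \<sigma> = map (\<lambda>(x, T). (\<sigma> x, permute_expr \<sigma> T))"


datatype struct_rule = Weakening | Projection

inductive_set derived :: "struct_rule set \<Rightarrow> 'w judgement set \<Rightarrow> 'w judgement set"
  for D :: "struct_rule set" and L :: "'w judgement set" where
  basic: "J \<in> L \<Longrightarrow> \<forall>B\<in>set (boundary J). B \<in> derived D L \<Longrightarrow> J \<in> derived D L"
| tm_refl: "(\<Gamma>, HasType t T) \<in> derived D L \<Longrightarrow> (\<Gamma>, EqTerm t t T) \<in> derived D L"
| tm_sym: "(\<Gamma>, EqTerm t1 t2 T) \<in> derived D L \<Longrightarrow> (\<Gamma>, EqTerm t2 t1 T) \<in> derived D L"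
| tm_trans: "(\<Gamma>, EqTerm t1 t2 T) \<in> derived D L \<Longrightarrow> (\<Gamma>, EqTerm t2 t3 T) \<in> derived D L
    \<Longrightarrow> (\<Gamma>, EqTerm t1 t3 T) \<in> derived D L"
| ty_refl: "(\<Gamma>, IsType T) \<in> derived D L \<Longrightarrow> (\<Gamma>, EqType T T) \<in> derived D L"
| ty_sym: "(\<Gamma>, EqType T1 T2) \<in> derived D L \<Longrightarrow> (\<Gamma>, EqType T2 T1) \<in> derived D L"
| ty_trans: "(\<Gamma>, EqType T1 T2) \<in> derived D L \<Longrightarrow> (\<Gamma>, EqType T2 T3) \<in> derived D L
    \<Longrightarrow> (\<Gamma>, EqType T1 T3) \<in> derived D L"
| conv_tm: "(\<Gamma>, EqType T1 T2) \<in> derived D L \<Longrightarrow> (\<Gamma>, HasType t T1) \<in> derived D L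
    \<Longrightarrow> (\<Gamma>, HasType t T2) \<in> derived D L"
| conv_eq: "(\<Gamma>, EqType T1 T2) \<in> derived D L \<Longrightarrow> (\<Gamma>, EqTerm t1 t2 T1) \<in> derived D L
    \<Longrightarrow> (\<Gamma>, EqTerm t1 t2 T2) \<in> derived D L"
| alpha: "bij \<sigma> \<Longrightarrow> (\<Gamma>, R) \<in> derived D L
    \<Longrightarrow> (permute_ctx \<sigma> \<Gamma>, map_rhs (permute_expr \<sigma>) R) \<in> derived D L"
| weaken: "Weakening \<in> D \<Longrightarrow> (\<Gamma>, IsType T) \<in> derived D L \<Longrightarrow> (\<Gamma> @ \<Delta>, R) \<in> derived D L
    \<Longrightarrow> y \<notin> ctx_vars \<Gamma> \<union> ctx_vars \<Delta> \<Longrightarrow> (\<Gamma> @ [(y, T)] @ \<Delta>, R) \<in> derived D L"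
| project: "Projection \<in> D \<Longrightarrow> (\<Gamma>, IsType T) \<in> derived D L
    \<Longrightarrow> y \<notin> ctx_vars \<Gamma> \<Longrightarrow> (\<Gamma> @ [(y, T)], HasType (Var y) T) \<in> derived D L"

text \<open>The alphabet \<open>\<Omega> \<amalg> \<Sigma>\<close> of a theory is a subset of the sum type \<open>'o + 's\<close>.\<close>

record ('o, 's) gat =
  ty_consts :: "'o set"
  tm_consts :: "'s set"
  basics :: "('o + 's) judgement set"

definition introduces_type :: "'o \<Rightarrow> ('o + 's) judgement \<Rightarrow> bool" where
  "introduces_type A J \<longleftrightarrow> (\<exists>\<Gamma>. J = (\<Gamma>, IsType (App (Inl A) (map (Var \<circ> fst) \<Gamma>))))"

definition introduces_term :: "'s \<Rightarrow> ('o + 's) judgement \<Rightarrow> bool" where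
  "introduces_term f J \<longleftrightarrow> (\<exists>\<Gamma> T. J = (\<Gamma>, HasType (App (Inr f) (map (Var \<circ> fst) \<Gamma>)) T))"

definition is_equality :: "'w judgement \<Rightarrow> bool" where
  "is_equality J \<longleftrightarrow>
     (\<exists>\<Gamma> T T'. J = (\<Gamma>, EqType T T')) \<or> (\<exists>\<Gamma> t t' T. J = (\<Gamma>, EqTerm t t' T))"

definition is_gat :: "struct_rule set \<Rightarrow> ('o, 's) gat \<Rightarrow> bool" where
  "is_gat D \<T> \<longleftrightarrow>
     (\<forall>J\<in>basics \<T>. judgement_over (ty_consts \<T> <+> tm_consts \<T>) J) \<and>
     (\<forall>A\<in>ty_consts \<T>. \<exists>!J. J \<in> basics \<T> \<and> introduces_type A J) \<and>
     (\<forall>f\<in>tm_consts \<T>. \<exists>!J. J \<in> basics \<T> \<and> introduces_term f J) \<and>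
     (\<forall>J\<in>basics \<T>. (\<exists>A\<in>ty_consts \<T>. introduces_type A J) \<or>
        (\<exists>f\<in>tm_consts \<T>. introduces_term f J) \<or> is_equality J) \<and>
     basics \<T> \<subseteq> derived D (basics \<T>)"

text \<open>In \<open>ty_eqv\<close> the \<open>i\<close>-th condition (counting from \<open>0\<close>) lives in the context of the first \<open>i\<close>
  declarations of the left-hand judgement.\<close>

definition ty_eqv ::
    "struct_rule set \<Rightarrow> ('o, 's) gat \<Rightarrow> ('o + 's) judgement \<Rightarrow> ('o + 's) judgement \<Rightarrow> bool" where
  "ty_eqv D \<T> J J' \<longleftrightarrow>
     (\<exists>\<Gamma> S \<Delta> T. J = (\<Gamma>, IsType S) \<and> J' = (\<Delta>, IsType T) \<and>
        J \<in> derived D (basics \<T>) \<and> J' \<in> derived D (basics \<T>) \<and> length \<Gamma> = length \<Delta> \<and>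
        (\<forall>i\<le>length \<Gamma>.
           (take i \<Gamma>, EqType ((map snd \<Gamma> @ [S]) ! i)
              (replace_vars (take i (map fst \<Gamma>)) (take i (map fst \<Delta>)) ((map snd \<Delta> @ [T]) ! i)))
           \<in> derived D (basics \<T>)))"

definition tm_eqv ::
    "struct_rule set \<Rightarrow> ('o, 's) gat \<Rightarrow> ('o + 's) judgement \<Rightarrow> ('o + 's) judgement \<Rightarrow> bool" where
  "tm_eqv D \<T> J J' \<longleftrightarrow>
     (\<exists>\<Gamma> s S \<Delta> t T. J = (\<Gamma>, HasType s S) \<and> J' = (\<Delta>, HasType t T) \<and>
        J \<in> derived D (basics \<T>) \<and> J' \<in> derived D (basics \<T>) \<and>
        ty_eqv D \<T> (\<Gamma>, IsType S) (\<Delta>, IsType T) \<and>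
        (\<Gamma>, EqTerm s (replace_vars (map fst \<Gamma>) (map fst \<Delta>) t) S) \<in> derived D (basics \<T>))"


text \<open>Since \<open>\<H>\<close> is free on a graph, a presheaf on it is a family of sets \<open>X(n) = tys X n\<close> and
  \<open>X(n\<^sub>t) = tms X n\<close> for \<open>n \<ge> 1\<close>, with arbitrary maps \<open>bd_ty X n : X(n+1) \<rightarrow> X(n)\<close> and
  \<open>bd_tm X n : X(n\<^sub>t) \<rightarrow> X(n)\<close>. The sets at the superfluous index \<open>0\<close> are required to be empty.\<close>

record ('a, 'b) psh =
  tys :: "nat \<Rightarrow> 'a set"
  tms :: "nat \<Rightarrow> 'b set"
  bd_ty :: "nat \<Rightarrow> 'a \<Rightarrow> 'a"
  bd_tm :: "nat \<Rightarrow> 'b \<Rightarrow> 'a"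

definition presheaf :: "('a, 'b) psh \<Rightarrow> bool" where
  "presheaf X \<longleftrightarrow> tys X 0 = {} \<and> tms X 0 = {} \<and>
     (\<forall>n\<ge>1. bd_ty X n \<in> tys X (Suc n) \<rightarrow> tys X n) \<and>
     (\<forall>n\<ge>1. bd_tm X n \<in> tms X n \<rightarrow> tys X n)"

definition Tm_over :: "('a, 'b) psh \<Rightarrow> nat \<Rightarrow> 'a \<Rightarrow> 'b set" where
  "Tm_over X n A = {a \<in> tms X n. bd_tm X n a = A}"

text \<open>Components of maps are extensional functions on the sets of the source, so that two maps of
  presheaves are equal as soon as they agree on all elements.\<close>

type_synonym ('a, 'b, 'c, 'd) psh_map = "(nat \<Rightarrow> 'a \<Rightarrow> 'c) \<times> (nat \<Rightarrow> 'b \<Rightarrow> 'd)"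

definition psh_hom :: "('a, 'b) psh \<Rightarrow> ('c, 'd) psh \<Rightarrow> ('a, 'b, 'c, 'd) psh_map set" where
  "psh_hom X Y = {(f, g).
     (\<forall>n. f n \<in> tys X n \<rightarrow>\<^sub>E tys Y n) \<and> (\<forall>n. g n \<in> tms X n \<rightarrow>\<^sub>E tms Y n) \<and>
     (\<forall>n\<ge>1. \<forall>A\<in>tys X (Suc n). f n (bd_ty X n A) = bd_ty Y n (f (Suc n) A)) \<and>
     (\<forall>n\<ge>1. \<forall>a\<in>tms X n. f n (bd_tm X n a) = bd_tm Y n (g n a))}"

definition psh_restrict ::
    "('a, 'b) psh \<Rightarrow> ('a, 'b, 'c, 'd) psh_map \<Rightarrow> ('a, 'b, 'c, 'd) psh_map" where
  "psh_restrict X f = (\<lambda>n. restrict (fst f n) (tys X n), \<lambda>n. restrict (snd f n) (tms X n))"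

text \<open>\<open>psh_comp X g f\<close> is the composite of \<open>f : X \<rightarrow> Y\<close> and \<open>g : Y \<rightarrow> Z\<close>; \<open>psh_inv X Y f\<close> is the
  inverse of an isomorphism \<open>f : X \<rightarrow> Y\<close>.\<close>

definition psh_comp :: "('a, 'b) psh \<Rightarrow> ('c, 'd, 'e, 'f) psh_map \<Rightarrow> ('a, 'b, 'c, 'd) psh_map
    \<Rightarrow> ('a, 'b, 'e, 'f) psh_map" where
  "psh_comp X g f =
     (\<lambda>n. compose (tys X n) (fst g n) (fst f n), \<lambda>n. compose (tms X n) (snd g n) (snd f n))"

definition psh_inv :: "('a, 'b) psh \<Rightarrow> ('c, 'd) psh \<Rightarrow> ('a, 'b, 'c, 'd) psh_map
    \<Rightarrow> ('c, 'd, 'a, 'b) psh_map" where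
  "psh_inv X Y f = psh_restrict Y
     (\<lambda>n. inv_into (tys X n) (fst f n), \<lambda>n. inv_into (tms X n) (snd f n))"


definition ty_class ::
    "struct_rule set \<Rightarrow> ('o, 's) gat \<Rightarrow> ('o + 's) judgement \<Rightarrow> ('o + 's) judgement set" where
  "ty_class D \<T> J = {J'. ty_eqv D \<T> J J'}"

definition tm_class ::
    "struct_rule set \<Rightarrow> ('o, 's) gat \<Rightarrow> ('o + 's) judgement \<Rightarrow> ('o + 's) judgement set" where
  "tm_class D \<T> J = {J'. tm_eqv D \<T> J J'}"

definition forget ::
    "struct_rule set \<Rightarrow> ('o, 's) gat \<Rightarrow> (('o + 's) judgement set, ('o + 's) judgement set) psh" where
  "forget D \<T> =
    \<lparr>tys = (\<lambda>n. {ty_class D \<T> (\<Gamma>, IsType T) | \<Gamma> T.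
        (\<Gamma>, IsType T) \<in> derived D (basics \<T>) \<and> degree (\<Gamma>, IsType T) = n}),
     tms = (\<lambda>n. {tm_class D \<T> (\<Gamma>, HasType t T) | \<Gamma> t T.
        (\<Gamma>, HasType t T) \<in> derived D (basics \<T>) \<and> degree (\<Gamma>, HasType t T) = n}),
     bd_ty = (\<lambda>n c. \<Union>J\<in>c. ty_class D \<T> (hd (boundary J))),
     bd_tm = (\<lambda>n c. \<Union>J\<in>c. ty_class D \<T> (hd (boundary J)))\<rparr>"


text \<open>\<open>bd_iter X n k\<close> is \<open>\<partial>\<^sup>k : X(n) \<rightarrow> X(n-k)\<close>.\<close>

primrec bd_iter :: "('a, 'b) psh \<Rightarrow> nat \<Rightarrow> nat \<Rightarrow> 'a \<Rightarrow> 'a" where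
  "bd_iter X n 0 A = A"
| "bd_iter X n (Suc k) A = bd_ty X (n - Suc k) (bd_iter X n k A)"

text \<open>The constants are the elements of \<open>X\<close> tagged by their degree, as the sets \<open>X(n)\<close> need not be
  disjoint. The variable \<open>x\<^sub>i\<close> is the number \<open>i\<close>.\<close>

type_synonym ('a, 'b) sym = "(nat \<times> 'a) + (nat \<times> 'b)"

definition gen_ctx :: "('a, 'b) psh \<Rightarrow> nat \<Rightarrow> 'a \<Rightarrow> ('a, 'b) sym ctx" where
  "gen_ctx X n A =
     map (\<lambda>i. (i, App (Inl (i, bd_iter X n (n - i) A)) (map Var [1..<i]))) [1..<n]"

definition ty_judgement :: "('a, 'b) psh \<Rightarrow> nat \<Rightarrow> 'a \<Rightarrow> ('a, 'b) sym judgement" where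
  "ty_judgement X n A = (gen_ctx X n A, IsType (App (Inl (n, A)) (map Var [1..<n])))"

definition tm_judgement :: "('a, 'b) psh \<Rightarrow> nat \<Rightarrow> 'b \<Rightarrow> ('a, 'b) sym judgement" where
  "tm_judgement X n a = (let A = bd_tm X n a in
     (gen_ctx X n A,
      HasType (App (Inr (n, a)) (map Var [1..<n])) (App (Inl (n, A)) (map Var [1..<n]))))"

definition free_gat :: "('a, 'b) psh \<Rightarrow> (nat \<times> 'a, nat \<times> 'b) gat" where
  "free_gat X =
    \<lparr>ty_consts = (SIGMA n:UNIV. tys X n),
     tm_consts = (SIGMA n:UNIV. tms X n),
     basics = {ty_judgement X n A | n A. A \<in> tys X n} \<union> {tm_judgement X n a | n a. a \<in> tms X n}\<rparr>"

lemma ty_pos: "presheaf X \<Longrightarrow> A \<in> tys X n \<Longrightarrow> n \<noteq> 0"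
  unfolding presheaf_def by (metis empty_iff)
lemma tm_pos: "presheaf X \<Longrightarrow> A \<in> tms X n \<Longrightarrow> n \<noteq> 0"
  unfolding presheaf_def by (metis empty_iff)

lemma bd_ty_in: "presheaf X \<Longrightarrow> n \<noteq> 0 \<Longrightarrow> A \<in> tys X (Suc n) \<Longrightarrow> bd_ty X n A \<in> tys X n"
  unfolding presheaf_def by (metis Pi_mem Suc_leI One_nat_def neq0_conv)

lemma bd_tm_in: "presheaf X \<Longrightarrow> a \<in> tms X n \<Longrightarrow> n \<noteq> 0 \<and> bd_tm X n a \<in> tys X n"
  unfolding presheaf_def by (metis Pi_mem Suc_leI One_nat_def neq0_conv empty_iff)

lemma bd_iter_shift: "k < n \<Longrightarrow> bd_iter X n (Suc k) A = bd_iter X (n - 1) k (bd_ty X (n - 1) A)"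
  by (induction k) auto

lemma gen_ctx_Suc:
  assumes "n \<ge> 1"
  shows "gen_ctx X (Suc n) A = gen_ctx X n (bd_ty X n A) @
     [(n, App (Inl (n, bd_ty X n A)) (map Var [1..<n]))]"
proof -
  have "bd_iter X (Suc n) (Suc n - i) A = bd_iter X n (n - i) (bd_ty X n A)" if "i \<in> {1..<n}" for i
    using that bd_iter_shift[of "n - i" "Suc n" X A] by (simp add: Suc_diff_le)
  then show ?thesis using assms by (simp add: gen_ctx_def)
qed

lemma ty_judgement_derived:
  assumes X: "presheaf X" and "A \<in> tys X n"
  shows "ty_judgement X n A \<in> derived D (basics (free_gat X))"
  using assms(2)
proof (induction n arbitrary: A)
  case 0
  then show ?case using X by (simp add: presheaf_def)
next
  case (Suc n)
  have b: "ty_judgement X (Suc n) A \<in> basics (free_gat X)"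
    using Suc.prems by (auto simp: free_gat_def)
  show ?case
  proof (cases "n = 0")
    case True
    then show ?thesis using b by (intro derived.basic) (auto simp: ty_judgement_def gen_ctx_def)
  next
    case False
    have "bd_ty X n A \<in> tys X n" using X Suc.prems False by (simp add: bd_ty_in)
    from Suc.IH[OF this] have "ty_judgement X n (bd_ty X n A) \<in> derived D (basics (free_gat X))" .
    with False show ?thesis
      by (intro derived.basic[OF b]) (auto simp: ty_judgement_def gen_ctx_Suc)
  qed
qed

lemma tm_judgement_derived:
  assumes X: "presheaf X" and "a \<in> tms X n"
  shows "tm_judgement X n a \<in> derived D (basics (free_gat X))"
proof -
  have "n \<noteq> 0" using assms by (cases n) (simp_all add: presheaf_def)
  have "bd_tm X n a \<in> tys X n" using assms by (simp add: bd_tm_in)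
  from ty_judgement_derived[OF X this, of D] show ?thesis
    using assms(2) by (intro derived.basic) (auto simp: free_gat_def tm_judgement_def ty_judgement_def Let_def)
qed

lemma bd_iter_in: "presheaf X \<Longrightarrow> A \<in> tys X n \<Longrightarrow> k < n \<Longrightarrow> bd_iter X n k A \<in> tys X (n - k)"
proof (induction k)
  case (Suc k)
  then have "bd_iter X n k A \<in> tys X (Suc (n - Suc k))" by (simp add: Suc_diff_Suc)
  with bd_ty_in[of X "n - Suc k"] Suc.prems show ?case by simp
qed auto

lemma fst_gen_ctx[simp]: "map fst (gen_ctx X n A) = [1..<n]" "map (Var \<circ> fst) (gen_ctx X n A) = map Var [1..<n]"
  by (simp_all add: gen_ctx_def comp_def)

lemma gen_ctx_syms: assumes "presheaf X" "A \<in> tys X n" "T \<in> snd ` set (gen_ctx X n A)"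
  shows "set_expr T \<subseteq> ty_consts (free_gat X) <+> tm_consts (free_gat X)"
proof -
  obtain i where i: "i \<in> {1..<n}" "T = App (Inl (i, bd_iter X n (n - i) A)) (map Var [1..<i])"
    using assms(3) by (auto simp: gen_ctx_def)
  with bd_iter_in[OF assms(1,2), of "n - i"] show ?thesis by (auto simp: free_gat_def)
qed

lemma free_gat_is_gat:
  assumes X: "presheaf X"
  shows "is_gat D (free_gat X)"
proof -
  have *: "bd_tm X n a \<in> tys X n" if "a \<in> tms X n" for n a
  proof -
    have "n \<noteq> 0" using assms that by (cases n) (simp_all add: presheaf_def)
    then show ?thesis using assms that by (simp add: bd_tm_in)
  qed
  have dist: "distinct (map fst (gen_ctx X n A))" for n A
    unfolding fst_gen_ctx by simp
  have 1: "\<forall>J\<in>basics (free_gat X). judgement_over (ty_consts (free_gat X) <+> tm_consts (free_gat X)) J"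
  proof
    fix J assume "J \<in> basics (free_gat X)"
    then consider n A where "J = ty_judgement X n A" "A \<in> tys X n"
      | n a where "J = tm_judgement X n a" "a \<in> tms X n" by (auto simp: free_gat_def)
    then show "judgement_over (ty_consts (free_gat X) <+> tm_consts (free_gat X)) J"
    proof cases
      case 1
      with dist[of n A] gen_ctx_syms[OF X 1(2)] show ?thesis
        unfolding judgement_over_def ty_judgement_def
        by (auto simp add: free_gat_def)
    next
      case 2
      with dist[of n "bd_tm X n a"] gen_ctx_syms[OF X *[OF 2(2)]] *[OF 2(2)] show ?thesis
        unfolding judgement_over_def tm_judgement_def Let_def
        by (auto simp add: free_gat_def)
    qed
  qed
  have 2: "\<forall>A\<in>ty_consts (free_gat X). \<exists>!J. J \<in> basics (free_gat X) \<and> introduces_type A J"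
    by (force simp: free_gat_def introduces_type_def ty_judgement_def tm_judgement_def Let_def)
  have 3: "\<forall>A\<in>tm_consts (free_gat X). \<exists>!J. J \<in> basics (free_gat X) \<and> introduces_term A J"
    by (force simp: free_gat_def introduces_term_def ty_judgement_def tm_judgement_def Let_def)
  have 4: "\<forall>J\<in>basics (free_gat X). (\<exists>A\<in>ty_consts (free_gat X). introduces_type A J) \<or>
        (\<exists>f\<in>tm_consts (free_gat X). introduces_term f J) \<or> is_equality J"
    by (force simp: free_gat_def introduces_type_def introduces_term_def ty_judgement_def tm_judgement_def Let_def)
  have 5: "basics (free_gat X) \<subseteq> derived D (basics (free_gat X))"
    using ty_judgement_derived[OF X] tm_judgement_derived[OF X] by (force simp: free_gat_def)
  show ?thesis unfolding is_gat_def using 1 2 3 4 5 by blast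
qed

text \<open>The object parts of the monads \<open>W\<close> and \<open>P\<close> are \<open>free_forget D\<close> for \<open>D = {w}\<close> and
  \<open>D = {w, p}\<close>. The unit of the adjunction between \<open>free_gat\<close> and \<open>forget D\<close>, which is the unit
  of the monad, sends an element of \<open>X\<close> to the class of its basic judgement.\<close>

definition free_forget :: "struct_rule set \<Rightarrow> ('a, 'b) psh
    \<Rightarrow> (('a, 'b) sym judgement set, ('a, 'b) sym judgement set) psh" where
  "free_forget D X = forget D (free_gat X)"

definition adj_unit :: "struct_rule set \<Rightarrow> ('a, 'b) psh
    \<Rightarrow> ('a, 'b, ('a, 'b) sym judgement set, ('a, 'b) sym judgement set) psh_map" where
  "adj_unit D X =
     (\<lambda>n. \<lambda>A\<in>tys X n. ty_class D (free_gat X) (ty_judgement X n A),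
      \<lambda>n. \<lambda>a\<in>tms X n. tm_class D (free_gat X) (tm_judgement X n a))"

abbreviation W_obj where "W_obj \<equiv> free_forget {Weakening}"
abbreviation P_obj where "P_obj \<equiv> free_forget {Weakening, Projection}"
abbreviation unit_W where "unit_W \<equiv> adj_unit {Weakening}"
abbreviation unit_P where "unit_P \<equiv> adj_unit {Weakening, Projection}"


definition Hp :: "nat \<Rightarrow> (nat \<Rightarrow> nat) set" where
  "Hp n = {\<phi> \<in> {0..n} \<rightarrow>\<^sub>E {0..n}. \<phi> 0 = 0 \<and> (\<forall>i\<in>{1..n}. \<phi> i < i)}"

definition dp :: "(nat \<Rightarrow> nat) \<Rightarrow> nat \<Rightarrow> nat" where
  "dp \<phi> i = card {(\<phi> ^^ k) i | k. k \<ge> 1}"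

definition heap_psh :: "nat \<Rightarrow> (nat \<Rightarrow> nat) \<Rightarrow> (nat, unit) psh" where
  "heap_psh n \<phi> =
    \<lparr>tys = (\<lambda>m. {i \<in> {1..n}. dp \<phi> i = m}), tms = (\<lambda>m. {}),
     bd_ty = (\<lambda>m i. \<phi> i), bd_tm = (\<lambda>m _. undefined)\<rparr>"

type_synonym ('a, 'b) heap = "(nat \<Rightarrow> nat) \<times> (nat, unit, 'a, 'b) psh_map"

definition heaps :: "('a, 'b) psh \<Rightarrow> nat \<Rightarrow> ('a, 'b) heap set" where
  "heaps X n = (if n = 0 then {} else SIGMA \<phi>:Hp n. psh_hom (heap_psh n \<phi>) X)"

definition label :: "('a, 'b) heap \<Rightarrow> nat \<Rightarrow> 'a" where
  "label = (\<lambda>(\<phi>, h) i. fst h (dp \<phi> i) i)"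

definition restrict_heap :: "nat \<Rightarrow> ('a, 'b) heap \<Rightarrow> ('a, 'b) heap" where
  "restrict_heap n =
     (\<lambda>(\<phi>, h). let \<psi> = restrict \<phi> {0..n} in (\<psi>, psh_restrict (heap_psh n \<psi>) h))"

definition W_heap :: "('a, 'b) psh \<Rightarrow> (('a, 'b) heap, ('a, 'b) heap \<times> 'b) psh" where
  "W_heap X =
    \<lparr>tys = heaps X,
     tms = (\<lambda>n. SIGMA H:heaps X n. Tm_over X (dp (fst H) n) (label H n)),
     bd_ty = restrict_heap, bd_tm = (\<lambda>n. fst)\<rparr>"

text \<open>\<open>Inr i\<close> is the projection \<open>\<pi>\<^sub>i\<close>.\<close>

definition P_heap :: "('a, 'b) psh \<Rightarrow> (('a, 'b) heap, ('a, 'b) heap \<times> ('b + nat)) psh" where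
  "P_heap X =
    \<lparr>tys = heaps X,
     tms = (\<lambda>n. SIGMA H:heaps X n. Tm_over X (dp (fst H) n) (label H n) <+>
        {i \<in> {1..n-1}. fst H n = fst H i \<and> label H n = label H i}),
     bd_ty = restrict_heap, bd_tm = (\<lambda>n. fst)\<rparr>"

definition heap_incl ::
    "('a, 'b) psh \<Rightarrow> (('a, 'b) heap, ('a, 'b) heap \<times> 'b, ('a, 'b) heap, ('a, 'b) heap \<times> ('b + nat)) psh_map"
  where
  "heap_incl X = psh_restrict (W_heap X) (\<lambda>n H. H, \<lambda>n (H, a). (H, Inl a))"

text \<open>\<open>heap_args \<phi> i\<close> is \<open>x\<^bsub>j(1)\<^esub>, ..., x\<^bsub>j(k-1)\<^esub>\<close> with \<open>k = dp \<phi> i\<close> and \<open>j(l) = \<phi>\<^bsup>k-l\<^esup>(i)\<close>: the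
  nonzero proper ancestors of \<open>i\<close>, the nearest one last.\<close>

definition heap_args :: "(nat \<Rightarrow> nat) \<Rightarrow> nat \<Rightarrow> 'w expr list" where
  "heap_args \<phi> i = map (\<lambda>l. Var ((\<phi> ^^ (dp \<phi> i - l)) i)) [1..<dp \<phi> i]"

definition heap_type :: "('a, 'b) heap \<Rightarrow> nat \<Rightarrow> ('a, 'b) sym expr" where
  "heap_type H i = App (Inl (dp (fst H) i, label H i)) (heap_args (fst H) i)"

definition heap_ctx :: "nat \<Rightarrow> ('a, 'b) heap \<Rightarrow> ('a, 'b) sym ctx" where
  "heap_ctx n H = map (\<lambda>i. (i, heap_type H i)) [1..<n]"

definition heap_const :: "nat \<Rightarrow> ('a, 'b) heap \<Rightarrow> 'b \<Rightarrow> ('a, 'b) sym expr" where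
  "heap_const n H a = App (Inr (dp (fst H) n, a)) (heap_args (fst H) n)"

definition W_ident :: "('a, 'b) psh
    \<Rightarrow> (('a, 'b) heap, ('a, 'b) heap \<times> 'b, ('a, 'b) sym judgement set, ('a, 'b) sym judgement set) psh_map"
  where
  "W_ident X = psh_restrict (W_heap X)
     (\<lambda>n H. ty_class {Weakening} (free_gat X) (heap_ctx n H, IsType (heap_type H n)),
      \<lambda>n (H, a). tm_class {Weakening} (free_gat X)
        (heap_ctx n H, HasType (heap_const n H a) (heap_type H n)))"

definition P_ident :: "('a, 'b) psh
    \<Rightarrow> (('a, 'b) heap, ('a, 'b) heap \<times> ('b + nat), ('a, 'b) sym judgement set, ('a, 'b) sym judgement set) psh_map"
  where
  "P_ident X = psh_restrict (P_heap X)
     (\<lambda>n H. ty_class {Weakening, Projection} (free_gat X) (heap_ctx n H, IsType (heap_type H n)),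
      \<lambda>n (H, c). tm_class {Weakening, Projection} (free_gat X)
        (heap_ctx n H, HasType (case c of Inl a \<Rightarrow> heap_const n H a | Inr i \<Rightarrow> Var i) (heap_type H n)))"

text \<open>\<open>W_ident X\<close> and \<open>P_ident X\<close> are the isomorphisms that identify \<open>W_heap X\<close> with \<open>W_obj X\<close> and
  \<open>P_heap X\<close> with \<open>P_obj X\<close>; \<open>\<theta>\<close> is the inclusion transported along them.\<close>

definition theta :: "('a, 'b) psh \<Rightarrow> (('a, 'b) sym judgement set, ('a, 'b) sym judgement set,
    ('a, 'b) sym judgement set, ('a, 'b) sym judgement set) psh_map" where
  "theta X = psh_comp (W_obj X) (P_ident X)
     (psh_comp (W_obj X) (heap_incl X) (psh_inv (W_heap X) (W_obj X) (W_ident X)))"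

end

theory Submission
  imports Defs
begin

text \<open>
  Write \<open>J\<^sub>A\<close> for the basic judgement of a type- or term-element \<open>A\<close> of \<open>X\<close>. The unit of either
  monad sends \<open>A\<close> to the class of \<open>J\<^sub>A\<close>, so the claim is that \<open>\<theta>\<close> maps the \<open>{w}\<close>-class of \<open>J\<^sub>A\<close> to
  its \<open>{w, p}\<close>-class. As \<open>\<theta>\<close> is the inclusion transported along the identifications of classes
  with labelled heaps, this is a question about a heap that represents the \<open>{w}\<close>-class of \<open>J\<^sub>A\<close>.

  Such a heap exists: in \<open>J\<^sub>A\<close> each type depends on all the preceding variables, so the heap is the
  linear one, in which the parent of \<open>i\<close> is \<open>i - 1\<close>, labelled by the iterated boundaries of \<open>A\<close>.
  The judgement attached to this heap is literally \<open>J\<^sub>A\<close> (\<open>heap_ctx_linear_heap\<close>,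
  \<open>heap_type_linear_heap\<close>).

  The inverse of the identification may be any choice of a preimage, so it remains to see that the
  choice does not matter. A free theory has no basic equalities, hence it derives only equalities
  between identical expressions (\<open>derived_equality_trivial\<close>), and equivalent judgements differ
  only in the names of their variables. Judgements attached to heaps of size \<open>n\<close> all use the
  variables \<open>1, ..., n - 1\<close>, and so does \<open>J\<^sub>A\<close>; therefore each heap that represents the \<open>{w}\<close>-class
  of \<open>J\<^sub>A\<close> has \<open>J\<^sub>A\<close> itself as its attached judgement, and its \<open>{w, p}\<close>-class is that of \<open>J\<^sub>A\<close>.
\<close>

section \<open>Equality in theories without equational axioms\<close>

text \<open>Every rule that concludes an equality either starts from reflexivity or propagates
  equalities that are identities by induction.\<close>

lemma derived_equality_trivial:
  assumes "J \<in> derived D L" and "\<forall>J\<in>L. \<not> is_equality J"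
  shows "case snd J of EqType T T' \<Rightarrow> T = T' | EqTerm t t' T \<Rightarrow> t = t' | _ \<Rightarrow> True"
  using assms(1)
proof (induction rule: derived.induct)
  case (basic J)
  then show ?case using assms(2)
    by (cases J; cases "snd J") (auto simp: is_equality_def)
next
  case (alpha \<sigma> \<Gamma> R)
  then show ?case by (cases R) auto
qed auto

lemma subst_Var: "subst Var e = e"
  by (induction e) (auto simp: map_idI)

lemma replace_vars_same: "replace_vars xs xs = (\<lambda>e. e)"
proof -
  have "(\<lambda>v. case map_of (zip xs xs) v of None \<Rightarrow> Var v | Some x \<Rightarrow> Var x) = Var"
    by (rule ext) (auto split: option.splits dest!: map_of_SomeD simp: in_set_zip)
  then have "replace_vars xs xs = subst Var" unfolding replace_vars_def by (rule arg_cong)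
  then show ?thesis by (simp add: fun_eq_iff subst_Var)
qed

text \<open>Without equational axioms \<open>\<equiv>\<close> is renaming of variables, so it is equality once the variables
  agree.\<close>

lemma ty_eqv_same_vars:
  assumes "ty_eqv D \<T> (\<Gamma>, IsType S) (\<Delta>, IsType T)"
    and vars: "map fst \<Gamma> = map fst \<Delta>"
    and noeq: "\<forall>J\<in>basics \<T>. \<not> is_equality J"
  shows "\<Gamma> = \<Delta> \<and> S = T"
proof -
  have len: "length \<Gamma> = length \<Delta>" using vars by (metis length_map)
  have "(map snd \<Gamma> @ [S]) ! i = (map snd \<Delta> @ [T]) ! i" if "i \<le> length \<Gamma>" for i
  proof -
    have "(take i \<Gamma>, EqType ((map snd \<Gamma> @ [S]) ! i) ((map snd \<Delta> @ [T]) ! i)) \<in> derived D (basics \<T>)"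
      using assms(1) that vars by (auto simp: ty_eqv_def replace_vars_same)
    from derived_equality_trivial[OF this noeq] show ?thesis by simp
  qed
  then have "map snd \<Gamma> @ [S] = map snd \<Delta> @ [T]"
    using len by (intro nth_equalityI) auto
  then have "map snd \<Gamma> = map snd \<Delta>" "S = T" by auto
  with vars show ?thesis by (metis zip_map_fst_snd)
qed

lemma tm_eqv_same_vars:
  assumes "tm_eqv D \<T> (\<Gamma>, HasType s S) (\<Delta>, HasType t T)"
    and vars: "map fst \<Gamma> = map fst \<Delta>"
    and noeq: "\<forall>J\<in>basics \<T>. \<not> is_equality J"
  shows "\<Gamma> = \<Delta> \<and> s = t \<and> S = T"
proof -
  have "ty_eqv D \<T> (\<Gamma>, IsType S) (\<Delta>, IsType T)"
    and "(\<Gamma>, EqTerm s t S) \<in> derived D (basics \<T>)"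
    using assms(1) vars by (auto simp: tm_eqv_def replace_vars_same)
  then show ?thesis
    using ty_eqv_same_vars[OF _ vars noeq] derived_equality_trivial[OF _ noeq] by fastforce
qed

lemma free_gat_no_equalities: "\<forall>J\<in>basics (free_gat X). \<not> is_equality J"
  by (auto simp: free_gat_def is_equality_def ty_judgement_def tm_judgement_def Let_def)

section \<open>Classes of basic judgements\<close>

lemma bd_iter_bd_iter:
  "j + k \<le> n \<Longrightarrow> bd_iter X (n - j) k (bd_iter X n j A) = bd_iter X n (j + k) A"
  by (induction k) (auto simp: diff_diff_eq)

text \<open>The initial segments of the context of \<open>J\<^sub>A\<close> are the contexts of the boundaries of \<open>A\<close>; this
  is what makes the reflexivity conditions for \<open>J\<^sub>A\<close> derivable.\<close>

lemma take_gen_ctx: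
  assumes "i < n"
  shows "take i (gen_ctx X n A) = gen_ctx X (Suc i) (bd_iter X n (n - Suc i) A)"
proof -
  have "bd_iter X (Suc i) (Suc i - j) (bd_iter X n (n - Suc i) A) = bd_iter X n (n - j) A"
    if "j \<in> {1..<Suc i}" for j
    using bd_iter_bd_iter[of "n - Suc i" "Suc i - j" n X A] that assms by simp
  then show ?thesis using assms by (auto simp: gen_ctx_def take_map take_upt simp del: upt_Suc)
qed

lemma ty_eqv_ty_judgement_refl:
  assumes X: "presheaf X" and A: "A \<in> tys X n"
  shows "ty_eqv D (free_gat X) (ty_judgement X n A) (ty_judgement X n A)"
proof -
  let ?T = "App (Inl (n, A)) (map Var [1..<n])"
  have n: "n \<noteq> 0" using ty_pos[OF X A] .
  have "(take i (gen_ctx X n A), EqType ((map snd (gen_ctx X n A) @ [?T]) ! i)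
      ((map snd (gen_ctx X n A) @ [?T]) ! i)) \<in> derived D (basics (free_gat X))" if "i < n" for i
  proof -
    let ?B = "bd_iter X n (n - Suc i) A"
    have "?B \<in> tys X (Suc i)"
      using bd_iter_in[OF X A, of "n - Suc i"] that by simp
    from ty_judgement_derived[OF X this, of D]
    have "(take i (gen_ctx X n A), IsType (App (Inl (Suc i, ?B)) (map Var [1..<Suc i])))
        \<in> derived D (basics (free_gat X))"
      using take_gen_ctx[OF that, of X A] by (simp only: ty_judgement_def)
    moreover have "(map snd (gen_ctx X n A) @ [?T]) ! i = App (Inl (Suc i, ?B)) (map Var [1..<Suc i])"
    proof (cases "Suc i = n")
      case True
      then show ?thesis by (auto simp: nth_append gen_ctx_def)
    next
      case False
      then have "i < n - 1" using that by simp
      then show ?thesis by (simp add: nth_append gen_ctx_def del: upt_Suc)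
    qed
    ultimately show ?thesis by (simp only: derived.ty_refl)
  qed
  then show ?thesis
    using ty_judgement_derived[OF X A, of D] n
    by (auto simp: ty_eqv_def ty_judgement_def replace_vars_same gen_ctx_def Suc_le_eq)
qed

lemma tm_eqv_tm_judgement_refl:
  assumes X: "presheaf X" and a: "a \<in> tms X n"
  shows "tm_eqv D (free_gat X) (tm_judgement X n a) (tm_judgement X n a)"
  using tm_judgement_derived[OF X a, of D] ty_eqv_ty_judgement_refl[OF X, of "bd_tm X n a" n D]
    bd_tm_in[OF X a]
  by (auto simp: tm_eqv_def tm_judgement_def ty_judgement_def Let_def replace_vars_same
      intro: derived.tm_refl)

text \<open>A class contains at most one judgement in the variables \<open>1, ..., n - 1\<close>. The judgement
  \<open>J\<^sub>A\<close> lies in its own class by reflexivity, so an equality of classes gives an equivalence of the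
  representatives.\<close>

lemma ty_judgement_unique:
  assumes X: "presheaf X" and A: "A \<in> tys X n" and vars: "map fst \<Gamma> = [1..<n]"
    and eq: "ty_class D (free_gat X) (\<Gamma>, IsType S) = ty_class D (free_gat X) (ty_judgement X n A)"
  shows "(\<Gamma>, IsType S) = ty_judgement X n A"
proof -
  have "ty_eqv D (free_gat X) (\<Gamma>, IsType S) (ty_judgement X n A)"
    using eq ty_eqv_ty_judgement_refl[OF X A, of D] by (auto simp: ty_class_def)
  then show ?thesis
    using ty_eqv_same_vars[OF _ _ free_gat_no_equalities] vars by (fastforce simp: ty_judgement_def)
qed

lemma tm_judgement_unique:
  assumes X: "presheaf X" and a: "a \<in> tms X n" and vars: "map fst \<Gamma> = [1..<n]"
    and eq: "tm_class D (free_gat X) (\<Gamma>, HasType s S) = tm_class D (free_gat X) (tm_judgement X n a)"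
  shows "(\<Gamma>, HasType s S) = tm_judgement X n a"
proof -
  have "tm_eqv D (free_gat X) (\<Gamma>, HasType s S) (tm_judgement X n a)"
    using eq tm_eqv_tm_judgement_refl[OF X a, of D] by (auto simp: tm_class_def)
  then show ?thesis
    using tm_eqv_same_vars[OF _ _ free_gat_no_equalities] vars
    by (fastforce simp: tm_judgement_def Let_def)
qed

lemma ty_class_in_free_forget:
  assumes X: "presheaf X" and A: "A \<in> tys X n"
  shows "ty_class D (free_gat X) (ty_judgement X n A) \<in> tys (free_forget D X) n"
  using ty_judgement_derived[OF X A, of D] ty_pos[OF X A]
  by (fastforce simp: free_forget_def forget_def ty_judgement_def degree_def gen_ctx_def)

lemma tm_class_in_free_forget:
  assumes X: "presheaf X" and a: "a \<in> tms X n"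
  shows "tm_class D (free_gat X) (tm_judgement X n a) \<in> tms (free_forget D X) n"
  using tm_judgement_derived[OF X a, of D] tm_pos[OF X a]
  by (fastforce simp: free_forget_def forget_def tm_judgement_def Let_def degree_def gen_ctx_def)

section \<open>The linear heap\<close>

definition linear :: "nat \<Rightarrow> nat \<Rightarrow> nat" where
  "linear n = restrict (\<lambda>i. i - 1) {0..n}"

text \<open>The vertex \<open>i\<close> carries the boundary of \<open>A\<close> of degree \<open>i\<close>. The presheaf of a heap has no
  term-elements, so restriction makes the second component the empty map.\<close>

definition linear_heap :: "('a, 'b) psh \<Rightarrow> nat \<Rightarrow> 'a \<Rightarrow> ('a, 'b) heap" where
  "linear_heap X n A =
     (linear n, psh_restrict (heap_psh n (linear n)) (\<lambda>m i. bd_iter X n (n - i) A, undefined))"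

lemma linear_funpow: "i \<le> n \<Longrightarrow> (linear n ^^ k) i = i - k"
  by (induction k) (auto simp: linear_def)

lemma dp_linear:
  assumes "1 \<le> i" and "i \<le> n"
  shows "dp (linear n) i = i"
proof -
  have "{(linear n ^^ k) i | k. k \<ge> 1} = {..<i}"
  proof (intro set_eqI iffI)
    fix j assume "j \<in> {..<i}"
    then have "j = (linear n ^^ (i - j)) i \<and> i - j \<ge> 1" using assms by (auto simp: linear_funpow)
    then show "j \<in> {(linear n ^^ k) i | k. k \<ge> 1}" by blast
  qed (use assms in \<open>auto simp: linear_funpow\<close>)
  then show ?thesis by (simp add: dp_def)
qed

lemma label_linear_heap:
  "1 \<le> i \<Longrightarrow> i \<le> n \<Longrightarrow> label (linear_heap X n A) i = bd_iter X n (n - i) A"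
  by (simp add: label_def linear_heap_def psh_restrict_def heap_psh_def dp_linear)

lemma fst_linear_heap: "fst (linear_heap X n A) = linear n"
  by (simp add: linear_heap_def)

lemma linear_heap_in_heaps:
  assumes X: "presheaf X" and A: "A \<in> tys X n"
  shows "linear_heap X n A \<in> heaps X n"
proof -
  have n: "n \<noteq> 0" using ty_pos[OF X A] .
  have "linear n \<in> Hp n"
    by (auto simp: Hp_def linear_def)
  moreover have "psh_restrict (heap_psh n (linear n)) (\<lambda>m i. bd_iter X n (n - i) A, undefined)
      \<in> psh_hom (heap_psh n (linear n)) X"
  proof -
    have label_in: "bd_iter X n (n - i) A \<in> tys X i" if "1 \<le> i" "i \<le> n" for i
      using bd_iter_in[OF X A, of "n - i"] that by simp
    have parent: "linear n (Suc m) = m" if "Suc m \<le> n" for m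
      using that by (simp add: linear_def)
    have step: "bd_iter X n (n - m) A = bd_ty X m (bd_iter X n (n - Suc m) A)" if "Suc m \<le> n" for m
    proof -
      have "n - m = Suc (n - Suc m)" and "n - (n - m) = m" using that by auto
      then show ?thesis by (metis bd_iter.simps(2))
    qed
    show ?thesis
      using label_in step
      by (auto simp: psh_hom_def psh_restrict_def heap_psh_def dp_linear parent)
  qed
  ultimately show ?thesis using n by (simp add: heaps_def linear_heap_def)
qed

text \<open>In the linear heap the ancestors of \<open>i\<close> are all the smaller numbers, so each constant is
  applied to the full list of preceding variables, as in a basic judgement.\<close>

lemma heap_args_linear:
  assumes "1 \<le> i" and "i \<le> n"
  shows "heap_args (linear n) i = map Var [1..<i]"
  using assms by (simp add: heap_args_def dp_linear linear_funpow)

lemma heap_type_linear_heap: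
  "1 \<le> i \<Longrightarrow> i \<le> n \<Longrightarrow>
    heap_type (linear_heap X n A) i = App (Inl (i, bd_iter X n (n - i) A)) (map Var [1..<i])"
  by (simp add: heap_type_def fst_linear_heap heap_args_linear dp_linear label_linear_heap)

lemma heap_ctx_linear_heap: "heap_ctx n (linear_heap X n A) = gen_ctx X n A"
  by (auto simp: heap_ctx_def gen_ctx_def heap_type_linear_heap)

lemma ty_judgement_linear_heap:
  assumes "presheaf X" and "A \<in> tys X n"
  shows "(heap_ctx n (linear_heap X n A), IsType (heap_type (linear_heap X n A) n)) = ty_judgement X n A"
  using ty_pos[OF assms] by (simp add: ty_judgement_def heap_ctx_linear_heap heap_type_linear_heap)

lemma tm_judgement_linear_heap:
  fixes X :: "('a, 'b) psh"
  assumes "presheaf X" and "a \<in> tms X n"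
  defines "H \<equiv> linear_heap X n (bd_tm X n a) :: ('a, 'b) heap"
  shows "(heap_ctx n H, HasType (heap_const n H a) (heap_type H n)) = tm_judgement X n a"
  using tm_pos[OF assms(1,2)]
  by (simp add: H_def tm_judgement_def Let_def heap_ctx_linear_heap heap_type_linear_heap
      heap_const_def fst_linear_heap heap_args_linear dp_linear)

lemma fst_heap_ctx: "map fst (heap_ctx n H) = [1..<n]"
  by (simp add: heap_ctx_def comp_def)

section \<open>The inclusion on classes of basic judgements\<close>

text \<open>Whichever preimage \<open>H\<close> of the \<open>{w}\<close>-class the inverse picks, its attached judgement is
  \<open>J\<^sub>A\<close>. The linear heap serves only to show that a preimage exists.\<close>

lemma theta_ty_judgement:
  fixes X :: "('a, 'b) psh"
  assumes X: "presheaf X" and A: "A \<in> tys X n"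
  shows "fst (theta X) n (ty_class {Weakening} (free_gat X) (ty_judgement X n A)) =
    ty_class {Weakening, Projection} (free_gat X) (ty_judgement X n A)"
proof -
  let ?c = "ty_class {Weakening} (free_gat X) (ty_judgement X n A)"
  let ?f = "fst (W_ident X) n"
  let ?H = "inv_into (heaps X n) ?f ?c"
  have f: "?f H = ty_class {Weakening} (free_gat X) (heap_ctx n H, IsType (heap_type H n))"
    if "H \<in> heaps X n" for H
    using that by (simp add: W_ident_def psh_restrict_def W_heap_def)
  have c: "?c \<in> ?f ` heaps X n"
  proof (rule image_eqI)
    show "linear_heap X n A \<in> heaps X n" by (rule linear_heap_in_heaps[OF X A])
    then show "?c = ?f (linear_heap X n A)"
      by (simp only: f ty_judgement_linear_heap[OF X A])
  qed
  have H: "?H \<in> heaps X n" and fH: "?f ?H = ?c"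
    using inv_into_into[OF c] f_inv_into_f[OF c] .
  have "fst (theta X) n ?c = fst (P_ident X) n ?H"
    using ty_class_in_free_forget[OF X A, of "{Weakening}"] H
    by (simp add: theta_def psh_comp_def compose_def psh_inv_def psh_restrict_def heap_incl_def W_heap_def)
  also have "\<dots> = ty_class {Weakening, Projection} (free_gat X) (heap_ctx n ?H, IsType (heap_type ?H n))"
    using H by (simp add: P_ident_def psh_restrict_def P_heap_def)
  also have "(heap_ctx n ?H, IsType (heap_type ?H n)) = ty_judgement X n A"
    by (rule ty_judgement_unique[OF X A fst_heap_ctx trans[OF f[OF H, symmetric] fH]])
  finally show ?thesis .
qed

lemma theta_tm_judgement:
  fixes X :: "('a, 'b) psh"
  assumes X: "presheaf X" and a: "a \<in> tms X n"
  shows "snd (theta X) n (tm_class {Weakening} (free_gat X) (tm_judgement X n a)) =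
    tm_class {Weakening, Projection} (free_gat X) (tm_judgement X n a)"
proof -
  let ?c = "tm_class {Weakening} (free_gat X) (tm_judgement X n a)"
  let ?f = "snd (W_ident X) n"
  let ?L = "linear_heap X n (bd_tm X n a) :: ('a, 'b) heap"
  let ?J = "\<lambda>(H, b). (heap_ctx n H, HasType (heap_const n H b) (heap_type H n))"
  have f: "?f p = tm_class {Weakening} (free_gat X) (?J p)" if "p \<in> tms (W_heap X) n" for p
    using that by (auto simp: W_ident_def psh_restrict_def)
  have n: "1 \<le> n" and A: "bd_tm X n a \<in> tys X n" using bd_tm_in[OF X a] by auto
  have "label ?L n = bd_tm X n a" using n by (simp add: label_linear_heap)
  then have La: "(?L, a) \<in> tms (W_heap X) n"
    using linear_heap_in_heaps[OF X A] a n
    by (simp add: W_heap_def Tm_over_def fst_linear_heap dp_linear)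
  have c: "?c \<in> ?f ` tms (W_heap X) n"
  proof (rule image_eqI)
    show "?c = ?f (?L, a)"
      by (simp only: f[OF La] case_prod_conv tm_judgement_linear_heap[OF X a])
  qed (rule La)
  obtain H b where p: "inv_into (tms (W_heap X) n) ?f ?c = (H, b)" by fastforce
  have in_tms: "(H, b) \<in> tms (W_heap X) n" and fp: "?f (H, b) = ?c"
    using inv_into_into[OF c] f_inv_into_f[OF c] unfolding p .
  have "snd (theta X) n ?c = snd (P_ident X) n (H, Inl b)"
    using tm_class_in_free_forget[OF X a, of "{Weakening}"] in_tms p
    by (simp add: theta_def psh_comp_def compose_def psh_inv_def psh_restrict_def heap_incl_def)
  also have "\<dots> = tm_class {Weakening, Projection} (free_gat X) (?J (H, b))"
    using in_tms p by (auto simp: P_ident_def psh_restrict_def P_heap_def W_heap_def)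
  also have "?J (H, b) = tm_judgement X n a"
    unfolding case_prod_conv
    by (rule tm_judgement_unique[OF X a fst_heap_ctx
        trans[OF f[OF in_tms, unfolded case_prod_conv, symmetric] fp]])
  finally show ?thesis .
qed

theorem proposition26:
  fixes X :: "('a, 'b) psh"
  assumes "presheaf X"
  shows "unit_P X = psh_comp X (theta X) (unit_W X)"
  using theta_ty_judgement[OF assms] theta_tm_judgement[OF assms]
  by (auto simp: adj_unit_def psh_comp_def compose_def fun_eq_iff)

end
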